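(* Let $D$ be a finite set of secrets and $M=\mathrm{QoI}(D)$. Let $p\in M_1$, $\Gamma,\Gamma':\mathit{Var}\to M_1$ and let $C$ be a command. If $p\vdash_M\Gamma\,\{C\}\,\Gamma'$ is derivable, then the semantic judgement $\models p\;\Gamma\,\{C\}\,\Gamma'$ holds, that is: (i) every variable $x$ with $p\not\sqsubseteq\Gamma'(x)$ is unchanged by $C$ (its final value equals its initial value whenever $C$ terminates); and (ii) for every mediator family $g$ legal for $\Gamma$ and every $W\subseteq\mathit{Var}$, $\pi_W\circ\llbracket C\rrbracket\circ\hat g:\bigotimes_{w\in W}\Gamma'(w)\Rightarrow\mathrm{Id}$. Consequently, if $(\sigma,W,\mathit{Pol})$ is a policy with $\sigma:\mathit{Var}\to M_1$, $W\subseteq\mathit{Var}$, $\mathit{Pol}\in M_1$, and $p\vdash_M\Gamma\,\{C\}\,\Gamma'$ is derivable with $\bigotimes_{w\in W}\Gamma'(w)\sqsubseteq\mathit{Pol}$ and $\sigma\sqsubseteq\Gamma$ pointwise, then $C$ complies with the policy: $\pi_W\circ\llbracket C\rrbracket\circ\hat g:\mathit{Pol}\Rightarrow\mathrm{Id}$ for every $g$ legal for $\sigma$.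
   Context: Quantale of information. $D$ is finite. $\mathrm{LoI}(D)$ is the set of equivalence relations on $D$ ordered by $P\sqsubseteq Q$ iff $Q\subseteq P$, so $P\sqcup Q=P\cap Q$, the least element $\mathrm{All}$ is the total relation and the greatest, $\mathrm{Id}$, is equality. For $\mathbb P\subseteq\mathrm{LoI}(D)$, $\mathrm{mix}(\mathbb P)$ is the set of equivalence relations each of whose cells is a cell of some member of $\mathbb P$, and $\mathrm{tc}(\mathbb P)={\downarrow}\mathrm{mix}(\mathbb P)$ (downward closure in $\mathrm{LoI}(D)$). $\mathrm{QoI}(D)$ is the set of $\mathbb P$ with $\mathrm{tc}(\mathbb P)=\mathbb P$, ordered by inclusion (written $\sqsubseteq$), with $\bigvee_i\mathbb P_i=\mathrm{tc}(\bigcup_i\mathbb P_i)$, $\mathbb P\otimes\mathbb Q=\mathrm{tc}\{P\sqcup Q\mid P\in\mathbb P,Q\in\mathbb Q\}$, unit $1=\{\mathrm{All}\}$; it is a commutative complete quantale. $M_1=\{m\in M\mid 1\sqsubseteq m\}$ (the nonempty elements). $m^0=1$, $m^n$ is the $n$-fold tensor power, $m^*=\bigvee_{n\ge0}m^n$. Empty tensors are $1$. Language. $\mathit{Var}$ is finite; stores are maps $\mathit{Var}\to\mathit{Val}$. Commands: $\mathsf{skip}$, $x:=E$, $C_1;C_2$, $\mathsf{if}\;E\;C_1\;C_2$, $\mathsf{while}\;E\;C$, with the standard semantics $\llbracket C\rrbracket$, a partial function on stores (undefined on nontermination). Expressions evaluate totally, their value depends only on the variables in $\mathit{fv}(E)$,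 and guards are decided by a fixed two-valued test on the value of $E$. $\mathit{asgn}(C)$ is the set of variables assigned in $C$. $\pi_W$ restricts a store to $W$. Typing rules. $\Gamma:\mathit{Var}\to M_1$, $p\in M_1$, $t_E(\Gamma)=\bigotimes_{v\in\mathit{fv}(E)}\Gamma(v)$. Derivability $p\vdash_M\Gamma\{C\}\Gamma'$ is generated by: (Skip) $p\vdash\Gamma\{\mathsf{skip}\}\Gamma$. (Assign) $p\vdash\Gamma\{x:=E\}\Gamma[x\mapsto p\otimes t_E(\Gamma)]$. (Seq) from $p\vdash\Gamma\{C_1\}\Gamma''$ and $p\vdash\Gamma''\{C_2\}\Gamma'$ infer $p\vdash\Gamma\{C_1;C_2\}\Gamma'$. (If) with $t=t_E(\Gamma)$, from $p\otimes t\vdash\Gamma\{C_i\}\Gamma_i'$ ($i=1,2$) infer $p\vdash\Gamma\{\mathsf{if}\;E\;C_1\;C_2\}\Gamma'$ where $\Gamma'(x)=t\otimes(\Gamma_1'(x)\vee\Gamma_2'(x))$ for $x\in\mathit{asgn}(C_1)\cup\mathit{asgn}(C_2)$ and $\Gamma'(x)=\Gamma(x)$ otherwise. (While) with $t=t_E(\Gamma)$, from $p\otimes t\vdash\Gamma\{C\}\Gamma$ infer $p\vdash\Gamma\{\mathsf{while}\;E\;C\}\Gamma^\dagger$ where $\Gamma^\dagger(x)=t^*\otimes\Gamma(x)$ for $x\in\mathit{asgn}(C)$ and $\Gamma^\dagger(x)=\Gamma(x)$ otherwise. (Sub) from $p\vdash\Gamma\{C\}\Gamma_1'$, $p'\sqsubseteq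 p$, $\Gamma'\sqsubseteq\Gamma$, $\Gamma_1'\sqsubseteq\Gamma_2'$ infer $p'\vdash\Gamma'\{C\}\Gamma_2'$. Mediators. For a partial function $h$ on $D$ and $\mathbb P\in\mathrm{QoI}(D)$, $h:\mathbb P\Rightarrow\mathrm{Id}$ means: some $P\in\mathbb P$ satisfies $h(d)=h(d')$ whenever $d\,P\,d'$ and both $h(d),h(d')$ are defined. A mediator family is $g=\langle g_v:D\rightharpoonup\mathit{Val}\rangle_{v\in\mathit{Var}}$ of partial functions with a common domain; $\hat g(d)$ is the store with $v$-component $g_v(d)$. $g$ is legal for $\Gamma$ when $g_v:\Gamma(v)\Rightarrow\mathrm{Id}$ for every $v$. *)

theory Defs
  imports "HOL-Algebra.FiniteProduct"
begin

text \<open>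
  An element of the lattice of information over \<open>D\<close> is an equivalence relation on \<open>D\<close>.
  Its order is reverse inclusion (finer means more informative), so the join of two relations
  is their intersection, the least element is \<open>D \<times> D\<close> and the greatest is \<open>Id_on D\<close>.
\<close>

definition LoI :: "'d set \<Rightarrow> 'd rel set" where
  "LoI D = {P. equiv D P}"

definition mix :: "'d set \<Rightarrow> 'd rel set \<Rightarrow> 'd rel set" where
  "mix D PP = {P \<in> LoI D. \<forall>c \<in> D // P. \<exists>Q \<in> PP. c \<in> D // Q}"

definition tc :: "'d set \<Rightarrow> 'd rel set \<Rightarrow> 'd rel set" where
  "tc D PP = {P \<in> LoI D. \<exists>Q \<in> mix D PP. Q \<subseteq> P}"

definition QoI :: "'d set \<Rightarrow> 'd rel set set" where
  "QoI D = {PP. PP \<subseteq> LoI D \<and> tc D PP = PP}"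

definition qjoin :: "'d set \<Rightarrow> 'd rel set set \<Rightarrow> 'd rel set" where
  "qjoin D A = tc D (\<Union>A)"

definition qtensor :: "'d set \<Rightarrow> 'd rel set \<Rightarrow> 'd rel set \<Rightarrow> 'd rel set" where
  "qtensor D PP QQ = tc D {P \<inter> Q | P Q. P \<in> PP \<and> Q \<in> QQ}"

text \<open>
  The multiplicative part of the quantale as a monoid record; finite tensors and tensor powers
  are then \<^const>\<open>finprod\<close> and \<open>[^]\<close>. The order of the quantale is plain inclusion, and
  the pointwise order on environments is the library order on functions into sets.
\<close>

definition qoi :: "'d set \<Rightarrow> 'd rel set monoid" where
  "qoi D = \<lparr>carrier = QoI D, monoid.mult = qtensor D, one = {D \<times> D}\<rparr>"

definition qoi1 :: "'d set \<Rightarrow> 'd rel set set" where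
  "qoi1 D = {m \<in> QoI D. \<one>\<^bsub>qoi D\<^esub> \<subseteq> m}"

definition qstar :: "'d set \<Rightarrow> 'd rel set \<Rightarrow> 'd rel set" where
  "qstar D m = qjoin D (range (\<lambda>n::nat. m [^]\<^bsub>qoi D\<^esub> n))"

datatype ('v, 'e) com =
    Skip
  | Assign 'v 'e
  | Seq "('v, 'e) com" "('v, 'e) com"
  | Cond 'e "('v, 'e) com" "('v, 'e) com"
  | While 'e "('v, 'e) com"

primrec asgn :: "('v, 'e) com \<Rightarrow> 'v set" where
  "asgn Skip = {}"
| "asgn (Assign x E) = {x}"
| "asgn (Seq C1 C2) = asgn C1 \<union> asgn C2"
| "asgn (Cond E C1 C2) = asgn C1 \<union> asgn C2"
| "asgn (While E C) = asgn C"

text \<open>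
  Expressions are an arbitrary type with a free-variable function \<open>fv\<close> and a total
  evaluation function \<open>ev\<close>; \<open>tst\<close> decides guards from the value of the guard expression.
\<close>

definition fv_sound :: "('e \<Rightarrow> 'v set) \<Rightarrow> ('e \<Rightarrow> ('v \<Rightarrow> 'a) \<Rightarrow> 'a) \<Rightarrow> bool" where
  "fv_sound fv ev \<longleftrightarrow> (\<forall>E s s'. (\<forall>v \<in> fv E. s v = s' v) \<longrightarrow> ev E s = ev E s')"

text \<open>The least fixed point of the loop equation in the flat order, undefined on divergence.\<close>

partial_function (option) while_sem :: "('s \<Rightarrow> bool) \<Rightarrow> ('s \<Rightarrow> 's option) \<Rightarrow> 's \<Rightarrow> 's option" where
  "while_sem b f s = (if b s then Option.bind (f s) (while_sem b f) else Some s)"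

primrec sem :: "('e \<Rightarrow> ('v \<Rightarrow> 'a) \<Rightarrow> 'a) \<Rightarrow> ('a \<Rightarrow> bool) \<Rightarrow> ('v, 'e) com
    \<Rightarrow> ('v \<Rightarrow> 'a) \<Rightarrow> ('v \<Rightarrow> 'a) option" where
  "sem ev tst Skip = Some"
| "sem ev tst (Assign x E) = (\<lambda>s. Some (s(x := ev E s)))"
| "sem ev tst (Seq C1 C2) = (\<lambda>s. Option.bind (sem ev tst C1 s) (sem ev tst C2))"
| "sem ev tst (Cond E C1 C2) =
     (\<lambda>s. if tst (ev E s) then sem ev tst C1 s else sem ev tst C2 s)"
| "sem ev tst (While E C) = while_sem (\<lambda>s. tst (ev E s)) (sem ev tst C)"

definition envs :: "'d set \<Rightarrow> ('v \<Rightarrow> 'd rel set) set" where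
  "envs D = UNIV \<rightarrow> qoi1 D"

definition texp :: "'d set \<Rightarrow> ('e \<Rightarrow> 'v set) \<Rightarrow> 'e \<Rightarrow> ('v \<Rightarrow> 'd rel set) \<Rightarrow> 'd rel set" where
  "texp D fv E \<Gamma> = (\<Otimes>\<^bsub>qoi D\<^esub> v \<in> fv E. \<Gamma> v)"

inductive typing :: "'d set \<Rightarrow> ('e \<Rightarrow> 'v::finite set) \<Rightarrow> 'd rel set
    \<Rightarrow> ('v \<Rightarrow> 'd rel set) \<Rightarrow> ('v, 'e) com \<Rightarrow> ('v \<Rightarrow> 'd rel set) \<Rightarrow> bool"
  for D :: "'d set" and fv :: "'e \<Rightarrow> 'v set" where
  T_Skip: "\<lbrakk>p \<in> qoi1 D; \<Gamma> \<in> envs D\<rbrakk> \<Longrightarrow> typing D fv p \<Gamma> Skip \<Gamma>"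
| T_Assign: "\<lbrakk>p \<in> qoi1 D; \<Gamma> \<in> envs D\<rbrakk> \<Longrightarrow>
    typing D fv p \<Gamma> (Assign x E) (\<Gamma>(x := p \<otimes>\<^bsub>qoi D\<^esub> texp D fv E \<Gamma>))"
| T_Seq: "\<lbrakk>typing D fv p \<Gamma> C1 \<Gamma>''; typing D fv p \<Gamma>'' C2 \<Gamma>'\<rbrakk> \<Longrightarrow>
    typing D fv p \<Gamma> (Seq C1 C2) \<Gamma>'"
| T_If: "\<lbrakk>p \<in> qoi1 D; \<Gamma> \<in> envs D; t = texp D fv E \<Gamma>;
      typing D fv (p \<otimes>\<^bsub>qoi D\<^esub> t) \<Gamma> C1 \<Gamma>1; typing D fv (p \<otimes>\<^bsub>qoi D\<^esub> t) \<Gamma> C2 \<Gamma>2\<rbrakk> \<Longrightarrow>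
    typing D fv p \<Gamma> (Cond E C1 C2)
      (\<lambda>x. if x \<in> asgn C1 \<union> asgn C2 then t \<otimes>\<^bsub>qoi D\<^esub> qjoin D {\<Gamma>1 x, \<Gamma>2 x} else \<Gamma> x)"
| T_While: "\<lbrakk>p \<in> qoi1 D; \<Gamma> \<in> envs D; t = texp D fv E \<Gamma>;
      typing D fv (p \<otimes>\<^bsub>qoi D\<^esub> t) \<Gamma> C \<Gamma>\<rbrakk> \<Longrightarrow>
    typing D fv p \<Gamma> (While E C)
      (\<lambda>x. if x \<in> asgn C then qstar D t \<otimes>\<^bsub>qoi D\<^esub> \<Gamma> x else \<Gamma> x)"
| T_Sub: "\<lbrakk>typing D fv p \<Gamma> C \<Gamma>1; p' \<in> qoi1 D; \<Gamma>' \<in> envs D; \<Gamma>2 \<in> envs D;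
      p' \<subseteq> p; \<Gamma>' \<le> \<Gamma>; \<Gamma>1 \<le> \<Gamma>2\<rbrakk> \<Longrightarrow>
    typing D fv p' \<Gamma>' C \<Gamma>2"

text \<open>The judgement \<open>h : PP \<Rightarrow> Id\<close>, for a partial function \<open>h\<close>.\<close>

definition mediates :: "('d \<Rightarrow> 'b option) \<Rightarrow> 'd rel set \<Rightarrow> bool" where
  "mediates h PP \<longleftrightarrow> (\<exists>P \<in> PP. \<forall>d d'. (d, d') \<in> P \<and> d \<in> dom h \<and> d' \<in> dom h \<longrightarrow> h d = h d')"

definition mediator_family :: "'d set \<Rightarrow> ('v \<Rightarrow> 'd \<Rightarrow> 'a option) \<Rightarrow> bool" where
  "mediator_family D g \<longleftrightarrow> (\<exists>A \<subseteq> D. \<forall>v. dom (g v) = A)"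

text \<open>For a mediator family the components share one domain, which is also the domain of
  \<open>hat g\<close>.\<close>

definition hat :: "('v \<Rightarrow> 'd \<Rightarrow> 'a option) \<Rightarrow> 'd \<Rightarrow> ('v \<Rightarrow> 'a) option" where
  "hat g d = (if \<forall>v. d \<in> dom (g v) then Some (\<lambda>v. the (g v d)) else None)"

definition legal :: "('v \<Rightarrow> 'd \<Rightarrow> 'a option) \<Rightarrow> ('v \<Rightarrow> 'd rel set) \<Rightarrow> bool" where
  "legal g \<Gamma> \<longleftrightarrow> (\<forall>v. mediates (g v) (\<Gamma> v))"

definition observe :: "('e \<Rightarrow> ('v \<Rightarrow> 'a) \<Rightarrow> 'a) \<Rightarrow> ('a \<Rightarrow> bool) \<Rightarrow> 'v set \<Rightarrow> ('v, 'e) com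
    \<Rightarrow> ('v \<Rightarrow> 'd \<Rightarrow> 'a option) \<Rightarrow> 'd \<Rightarrow> ('v \<Rightarrow> 'a) option" where
  "observe ev tst W C g = map_option (\<lambda>s. restrict s W) \<circ> (sem ev tst C \<circ>\<^sub>m hat g)"

definition sem_judgement :: "'d set \<Rightarrow> ('e \<Rightarrow> ('v::finite \<Rightarrow> 'a) \<Rightarrow> 'a) \<Rightarrow> ('a \<Rightarrow> bool)
    \<Rightarrow> 'd rel set \<Rightarrow> ('v \<Rightarrow> 'd rel set) \<Rightarrow> ('v, 'e) com \<Rightarrow> ('v \<Rightarrow> 'd rel set) \<Rightarrow> bool" where
  "sem_judgement D ev tst p \<Gamma> C \<Gamma>' \<longleftrightarrow>
     (\<forall>x. \<not> p \<subseteq> \<Gamma>' x \<longrightarrow> (\<forall>s s'. sem ev tst C s = Some s' \<longrightarrow> s' x = s x)) \<and>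
     (\<forall>g W. mediator_family D g \<and> legal g \<Gamma> \<longrightarrow>
        mediates (observe ev tst W C g) (\<Otimes>\<^bsub>qoi D\<^esub> w \<in> W. \<Gamma>' w))"

definition complies :: "'d set \<Rightarrow> ('e \<Rightarrow> ('v \<Rightarrow> 'a) \<Rightarrow> 'a) \<Rightarrow> ('a \<Rightarrow> bool) \<Rightarrow> ('v, 'e) com
    \<Rightarrow> ('v \<Rightarrow> 'd rel set) \<Rightarrow> 'v set \<Rightarrow> 'd rel set \<Rightarrow> bool" where
  "complies D ev tst C \<sigma> W Pol \<longleftrightarrow>
     (\<forall>g. mediator_family D g \<and> legal g \<sigma> \<longrightarrow> mediates (observe ev tst W C g) Pol)"

end

theory Submission imports Defs
begin

text \<open>
  Soundness is proved by induction on the derivation for single observed variables; a joint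
  observation of \<open>W\<close> is mediated by the intersection of the relations mediating its members.
  At a branch or a loop exit, the cells of a relation mediating the guards determine which
  branch is taken, respectively how many iterations are made (boundedly many, as \<open>D\<close> is
  finite). Inside each such cell one uses the relation that mediates the outcome of that branch
  or iteration. The relation glued together in this way is a mix, so it lies in the tensor.
\<close>

section \<open>The quantale of information\<close>

lemma LoI_total: "D \<times> D \<in> LoI D"
  by (auto simp: LoI_def equiv_def refl_on_def sym_def trans_def)

lemma LoI_inter: "P \<in> LoI D \<Longrightarrow> Q \<in> LoI D \<Longrightarrow> P \<inter> Q \<in> LoI D"
  by (auto simp: LoI_def equiv_def refl_on_def intro: sym_Int trans_Int)

lemma LoI_subset: "P \<in> LoI D \<Longrightarrow> P \<subseteq> D \<times> D"
  by (auto simp: LoI_def equiv_def)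

text \<open>A cell of \<open>Q\<close> that contains \<open>x\<close> can only be the cell of
  \<open>x\<close> under \<open>Q\<close>. The condition on quotient sets can therefore be tested
  point by point.\<close>

lemma mix_iff:
  assumes X: "X \<subseteq> LoI D"
  shows "P \<in> mix D X \<longleftrightarrow> P \<in> LoI D \<and> (\<forall>x\<in>D. \<exists>Q\<in>X. Q `` {x} = P `` {x})"
proof
  assume P: "P \<in> mix D X"
  then have L: "P \<in> LoI D" by (simp add: mix_def)
  have "\<exists>Q\<in>X. Q `` {x} = P `` {x}" if x: "x \<in> D" for x
  proof -
    have "P `` {x} \<in> D // P" using x by (rule quotientI)
    with P obtain Q where Q: "Q \<in> X" "P `` {x} \<in> D // Q" by (auto simp: mix_def)
    then obtain y where y: "P `` {x} = Q `` {y}" by (auto elim: quotientE)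
    have "x \<in> Q `` {y}" using L x y equiv_class_self[of D P x] by (simp add: LoI_def)
    moreover have "equiv D Q" using Q X by (auto simp: LoI_def)
    ultimately have "Q `` {y} = Q `` {x}" by (intro equiv_class_eq[of D]) auto
    with Q y show ?thesis by auto
  qed
  with L show "P \<in> LoI D \<and> (\<forall>x\<in>D. \<exists>Q\<in>X. Q `` {x} = P `` {x})" by blast
next
  assume P: "P \<in> LoI D \<and> (\<forall>x\<in>D. \<exists>Q\<in>X. Q `` {x} = P `` {x})"
  have "\<exists>Q\<in>X. c \<in> D // Q" if "c \<in> D // P" for c
  proof -
    from that obtain x where x: "x \<in> D" "c = P `` {x}" by (auto elim: quotientE)
    with P obtain Q where "Q \<in> X" "Q `` {x} = c" by blast
    with x show ?thesis using quotientI[of x D Q] by auto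
  qed
  with P show "P \<in> mix D X" by (auto simp: mix_def)
qed

lemma tc_iff:
  assumes "X \<subseteq> LoI D"
  shows "P \<in> tc D X \<longleftrightarrow>
    P \<in> LoI D \<and> (\<exists>S \<in> LoI D. S \<subseteq> P \<and> (\<forall>x\<in>D. \<exists>Q\<in>X. Q `` {x} = S `` {x}))"
  using mix_iff[OF assms] by (auto simp: tc_def)

lemma tcI:
  assumes "X \<subseteq> LoI D" "P \<in> LoI D" "S \<in> LoI D" "S \<subseteq> P"
    and "\<And>x. x \<in> D \<Longrightarrow> \<exists>Q\<in>X. Q `` {x} = S `` {x}"
  shows "P \<in> tc D X"
  unfolding tc_iff[OF assms(1)] using assms by blast

lemma tc_subset_LoI: "tc D X \<subseteq> LoI D"
  by (auto simp: tc_def)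

lemma subset_tc: "X \<subseteq> LoI D \<Longrightarrow> X \<subseteq> tc D X"
proof
  fix P assume "X \<subseteq> LoI D" and "P \<in> X"
  then show "P \<in> tc D X" unfolding tc_iff[OF \<open>X \<subseteq> LoI D\<close>] by blast
qed

lemma tc_mono: "X \<subseteq> Y \<Longrightarrow> tc D X \<subseteq> tc D Y"
proof -
  assume "X \<subseteq> Y"
  then have "mix D X \<subseteq> mix D Y" by (fastforce simp: mix_def)
  then show ?thesis by (auto simp: tc_def)
qed

text \<open>Each cell of \<open>T\<close> is cut further by a relation chosen for that cell. The
  choice \<open>R\<close> is indexed by points, but it is meant to be constant on the cells of
  \<open>T\<close>.\<close>

definition glue :: "'d rel \<Rightarrow> ('d \<Rightarrow> 'd rel) \<Rightarrow> 'd rel" where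
  "glue T R = {(x, y). (x, y) \<in> T \<inter> R x}"

text \<open>Symmetry and transitivity involve \<open>R\<close> at different but related points;
  constancy along \<open>T\<close> makes these one and the same equivalence relation.\<close>

lemma glue_LoI:
  assumes T: "T \<in> LoI D" and R: "\<And>x. x \<in> D \<Longrightarrow> R x \<in> LoI D"
    and const: "\<And>x y. (x, y) \<in> T \<Longrightarrow> R x = R y"
  shows "glue T R \<in> LoI D"
proof -
  have eq: "equiv D T" "\<And>x. x \<in> D \<Longrightarrow> equiv D (R x)" using T R by (auto simp: LoI_def)
  have sub: "T \<subseteq> D \<times> D" using T by (rule LoI_subset)
  have "equiv D (glue T R)"
  proof (rule equivI)
    show "glue T R \<subseteq> D \<times> D" using sub by (auto simp: glue_def)
    show "refl_on D (glue T R)"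
      using eq by (auto simp: glue_def refl_on_def equiv_def)
    show "sym (glue T R)"
    proof (rule symI)
      fix x y assume "(x, y) \<in> glue T R"
      then have xy: "(x, y) \<in> T" "(x, y) \<in> R x" by (simp_all add: glue_def)
      then have "x \<in> D" using sub by blast
      then have "sym T" "sym (R x)" using eq by (auto simp: equiv_def)
      then show "(y, x) \<in> glue T R"
        using xy const[OF xy(1)] by (simp add: glue_def symD)
    qed
    show "trans (glue T R)"
    proof (rule transI)
      fix x y z assume "(x, y) \<in> glue T R" "(y, z) \<in> glue T R"
      then have h: "(x, y) \<in> T" "(x, y) \<in> R x" "(y, z) \<in> T" "(y, z) \<in> R y"
        by (simp_all add: glue_def)
      then have "x \<in> D" using sub by blast
      then have "trans T" "trans (R x)" using eq by (auto simp: equiv_def)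
      then show "(x, z) \<in> glue T R"
        using h const[OF h(1)] by (simp add: glue_def) (blast dest: transD)
    qed
  qed
  then show ?thesis by (simp add: LoI_def)
qed

text \<open>Below \<open>P\<close> lies some \<open>Q\<close> whose cells come from members of
  \<open>tc D X\<close>, and each such member is refined by a mix of \<open>X\<close>. Gluing these
  refinements along the cells of \<open>Q\<close> gives a single mix of \<open>X\<close> below
  \<open>P\<close>.\<close>

lemma tc_idem:
  assumes X: "X \<subseteq> LoI D"
  shows "tc D (tc D X) = tc D X"
proof
  show "tc D X \<subseteq> tc D (tc D X)" by (rule subset_tc[OF tc_subset_LoI])
  show "tc D (tc D X) \<subseteq> tc D X"
  proof
    fix P assume "P \<in> tc D (tc D X)"
    then obtain Q where P: "P \<in> LoI D" and Q: "Q \<in> LoI D" "Q \<subseteq> P"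
      and cells: "\<And>x. x \<in> D \<Longrightarrow> \<exists>R \<in> tc D X. R `` {x} = Q `` {x}"
      unfolding tc_iff[OF tc_subset_LoI] by blast
    have eqQ: "equiv D Q" using Q by (simp add: LoI_def)
    \<comment> \<open>The refinement is chosen per cell \<open>c\<close> and not per point, which
      makes it constant along \<open>Q\<close>. Its cells at points of \<open>c\<close> must stay
      inside \<open>c\<close>, for otherwise gluing would cut them.\<close>
    have "\<exists>S\<in>LoI D. (\<forall>y\<in>D. \<exists>Z\<in>X. Z `` {y} = S `` {y}) \<and>
        (\<forall>x\<in>D. Q `` {x} = c \<longrightarrow> S `` {x} \<subseteq> c)" if "c \<in> D // Q" for c
    proof -
      from that obtain x where x: "x \<in> D" "c = Q `` {x}" by (auto elim: quotientE)
      with cells obtain R where R: "R \<in> tc D X" "R `` {x} = c" by blast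
      then obtain S where S: "S \<in> LoI D" "S \<subseteq> R" "\<forall>y\<in>D. \<exists>Z\<in>X. Z `` {y} = S `` {y}"
        unfolding tc_iff[OF X] by blast
      have eqR: "equiv D R" using R tc_subset_LoI by (auto simp: LoI_def)
      have "S `` {y} \<subseteq> c" if "y \<in> D" "Q `` {y} = c" for y
      proof -
        have "(x, y) \<in> R" using equiv_class_self[OF eqQ that(1)] that(2) R(2) by auto
        then have "R `` {y} = c" using equiv_class_eq[OF eqR] R(2) by metis
        then show ?thesis using S(2) by auto
      qed
      with S show ?thesis by blast
    qed
    then obtain S where S: "\<And>c. c \<in> D // Q \<Longrightarrow> S c \<in> LoI D"
      "\<And>c y. c \<in> D // Q \<Longrightarrow> y \<in> D \<Longrightarrow> \<exists>Z\<in>X. Z `` {y} = S c `` {y}"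
      "\<And>c x. c \<in> D // Q \<Longrightarrow> x \<in> D \<Longrightarrow> Q `` {x} = c \<Longrightarrow> S c `` {x} \<subseteq> c"
      by metis
    let ?G = "glue Q (\<lambda>x. S (Q `` {x}))"
    have "?G \<in> LoI D"
    proof (rule glue_LoI[OF Q(1)])
      show "S (Q `` {x}) \<in> LoI D" if "x \<in> D" for x
        by (rule S(1)) (rule quotientI[OF that])
      show "S (Q `` {x}) = S (Q `` {y})" if "(x, y) \<in> Q" for x y
        using equiv_class_eq[OF eqQ that] by simp
    qed
    moreover have "?G \<subseteq> P" using Q by (auto simp: glue_def)
    moreover have "\<exists>Z\<in>X. Z `` {x} = ?G `` {x}" if x: "x \<in> D" for x
    proof -
      have c: "Q `` {x} \<in> D // Q" using x by (rule quotientI)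
      \<comment> \<open>Intersecting with \<open>Q\<close> removes nothing here, so the cell is
        still a cell of a member of \<open>X\<close>.\<close>
      have "?G `` {x} = S (Q `` {x}) `` {x}"
        using S(3)[OF c x refl] by (auto simp: glue_def)
      with S(2)[OF c x] show ?thesis by simp
    qed
    ultimately show "P \<in> tc D X" using P unfolding tc_iff[OF X] by blast
  qed
qed

lemma tc_least: "X \<subseteq> tc D Y \<Longrightarrow> Y \<subseteq> LoI D \<Longrightarrow> tc D X \<subseteq> tc D Y"
  using tc_mono tc_idem by metis

lemma tc_QoI: "X \<subseteq> LoI D \<Longrightarrow> tc D X \<in> QoI D"
  by (simp add: QoI_def tc_idem tc_subset_LoI)

lemma QoI_subset_LoI: "A \<in> QoI D \<Longrightarrow> A \<subseteq> LoI D"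
  by (simp add: QoI_def)

section \<open>The tensor as closure of pairwise intersections\<close>

abbreviation meets :: "'d rel set \<Rightarrow> 'd rel set \<Rightarrow> 'd rel set" where
  "meets A B \<equiv> {P \<inter> Q | P Q. P \<in> A \<and> Q \<in> B}"

lemma meets_LoI: "A \<subseteq> LoI D \<Longrightarrow> B \<subseteq> LoI D \<Longrightarrow> meets A B \<subseteq> LoI D"
  by (auto intro: LoI_inter)

lemma meets_commute: "meets A B = meets B A"
  by (auto simp: Int_commute)

lemma meets_assoc: "meets (meets A B) C = meets A (meets B C)"
proof (intro subset_antisym subsetI)
  fix X assume "X \<in> meets (meets A B) C"
  then obtain P Q R where "P \<in> A" "Q \<in> B" "R \<in> C" "X = P \<inter> (Q \<inter> R)"
    by (auto simp: Int_assoc)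
  then show "X \<in> meets A (meets B C)" by blast
next
  fix X assume "X \<in> meets A (meets B C)"
  then obtain P Q R where "P \<in> A" "Q \<in> B" "R \<in> C" "X = P \<inter> Q \<inter> R"
    by (auto simp: Int_assoc)
  then show "X \<in> meets (meets A B) C" by blast
qed

text \<open>The cell of \<open>P \<inter> Z\<close> at \<open>x\<close> depends on \<open>Z\<close>
  only through its cell at \<open>x\<close>. Hence intersecting with a fixed \<open>P\<close> turns
  a mix of \<open>B\<close> into a mix of \<open>meets A B\<close>, and closing one factor early
  changes nothing.\<close>

lemma tc_meets_tc:
  assumes A: "A \<subseteq> LoI D" and B: "B \<subseteq> LoI D"
  shows "tc D (meets A (tc D B)) = tc D (meets A B)"
proof
  show "tc D (meets A B) \<subseteq> tc D (meets A (tc D B))"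
    using subset_tc[OF B] by (intro tc_mono) blast
  have "P \<inter> Q \<in> tc D (meets A B)" if P: "P \<in> A" and Q: "Q \<in> tc D B" for P Q
  proof -
    from Q obtain S where S: "Q \<in> LoI D" "S \<in> LoI D" "S \<subseteq> Q"
      and cells: "\<And>x. x \<in> D \<Longrightarrow> \<exists>Z\<in>B. Z `` {x} = S `` {x}" unfolding tc_iff[OF B] by blast
    have "\<exists>Z\<in>meets A B. Z `` {x} = (P \<inter> S) `` {x}" if x: "x \<in> D" for x
    proof -
      from cells[OF x] obtain Z where Z: "Z \<in> B" "Z `` {x} = S `` {x}" by blast
      then have "(P \<inter> Z) `` {x} = (P \<inter> S) `` {x}" by blast
      with P Z show ?thesis by blast
    qed
    moreover have "P \<inter> Q \<in> LoI D" "P \<inter> S \<in> LoI D" "P \<inter> S \<subseteq> P \<inter> Q"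
      using P A S by (auto intro: LoI_inter)
    ultimately show ?thesis by (intro tcI[OF meets_LoI[OF A B], where S = "P \<inter> S"])
  qed
  then show "tc D (meets A (tc D B)) \<subseteq> tc D (meets A B)"
    by (intro tc_least meets_LoI A B) blast
qed

lemma qtensor_QoI: "A \<subseteq> LoI D \<Longrightarrow> B \<subseteq> LoI D \<Longrightarrow> qtensor D A B \<in> QoI D"
  unfolding qtensor_def by (intro tc_QoI meets_LoI)

lemma qtensor_commute: "qtensor D A B = qtensor D B A"
  unfolding qtensor_def by (rule arg_cong[OF meets_commute])

lemma qtensor_assoc:
  assumes "A \<subseteq> LoI D" "B \<subseteq> LoI D" "C \<subseteq> LoI D"
  shows "qtensor D (qtensor D A B) C = qtensor D A (qtensor D B C)"
proof -
  have "qtensor D (qtensor D A B) C = tc D (meets C (tc D (meets A B)))"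
    by (subst qtensor_commute) (simp add: qtensor_def)
  also have "\<dots> = tc D (meets (meets A B) C)"
    by (subst tc_meets_tc[OF assms(3) meets_LoI[OF assms(1,2)]]) (rule arg_cong[OF meets_commute])
  also have "\<dots> = tc D (meets A (tc D (meets B C)))"
    by (subst tc_meets_tc[OF assms(1) meets_LoI[OF assms(2,3)]]) (rule arg_cong[OF meets_assoc])
  finally show ?thesis by (simp add: qtensor_def)
qed

lemma qtensor_unit: "A \<in> QoI D \<Longrightarrow> qtensor D {D \<times> D} A = A"
proof -
  assume A: "A \<in> QoI D"
  then have "meets {D \<times> D} A = A"
    using LoI_subset by (fastforce simp: QoI_def inf.absorb2)
  then show ?thesis using A by (simp add: qtensor_def QoI_def)
qed

lemma unit_QoI: "{D \<times> D} \<in> QoI D"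
proof -
  \<comment> \<open>A mix of \<open>{D \<times> D}\<close> has \<open>D\<close> as the cell of every
    point, so it is total, and so is every relation that contains it.\<close>
  have "P = D \<times> D" if P: "P \<in> tc D {D \<times> D}" for P
  proof -
    have X: "{D \<times> D} \<subseteq> LoI D" using LoI_total by blast
    obtain S where S: "S \<subseteq> P" "\<And>x. x \<in> D \<Longrightarrow> (D \<times> D) `` {x} = S `` {x}" and "P \<in> LoI D"
      using P unfolding tc_iff[OF X] by blast
    then have "P \<subseteq> D \<times> D" by (intro LoI_subset)
    moreover have "D \<times> D \<subseteq> P" using S by blast
    ultimately show ?thesis by blast
  qed
  then show ?thesis using subset_tc[of "{D \<times> D}" D] LoI_total by (auto simp: QoI_def)
qed

lemma qoi_simps [simp]:
  "carrier (qoi D) = QoI D" "monoid.mult (qoi D) = qtensor D" "\<one>\<^bsub>qoi D\<^esub> = {D \<times> D}"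
  by (simp_all add: qoi_def)

lemma comm_monoid_qoi: "comm_monoid (qoi D)"
  by (rule comm_monoidI)
    (simp_all add: QoI_subset_LoI qtensor_QoI unit_QoI qtensor_assoc qtensor_unit,
      rule qtensor_commute)

lemma qtensorI: "A \<in> QoI D \<Longrightarrow> B \<in> QoI D \<Longrightarrow> P \<in> A \<Longrightarrow> Q \<in> B \<Longrightarrow> P \<inter> Q \<in> qtensor D A B"
  using subset_tc[OF meets_LoI[of A D B]] QoI_subset_LoI[of A D] QoI_subset_LoI[of B D]
  unfolding qtensor_def by blast

section \<open>Elements above the unit, joins, finite tensors and powers\<close>

lemma qoi1_iff: "m \<in> qoi1 D \<longleftrightarrow> m \<in> QoI D \<and> D \<times> D \<in> m"
  by (simp add: qoi1_def)

lemma qtensor_upper2: "A \<in> qoi1 D \<Longrightarrow> B \<in> QoI D \<Longrightarrow> B \<subseteq> qtensor D A B"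
proof
  fix P assume h: "A \<in> qoi1 D" "B \<in> QoI D" "P \<in> B"
  then have "P \<subseteq> D \<times> D" by (intro LoI_subset) (auto dest: QoI_subset_LoI)
  then have "D \<times> D \<inter> P = P" by blast
  with h qtensorI[of A D B "D \<times> D" P] show "P \<in> qtensor D A B" by (simp add: qoi1_iff)
qed

lemma qtensor_upper1: "A \<in> QoI D \<Longrightarrow> B \<in> qoi1 D \<Longrightarrow> A \<subseteq> qtensor D A B"
  using qtensor_upper2 qtensor_commute by metis

lemma qtensor_qoi1: "A \<in> qoi1 D \<Longrightarrow> B \<in> qoi1 D \<Longrightarrow> qtensor D A B \<in> qoi1 D"
  using qtensorI[of A D B "D \<times> D" "D \<times> D"]
  by (simp add: qoi1_iff qtensor_QoI QoI_subset_LoI)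

lemma qjoin_upper: "(\<And>m. m \<in> A \<Longrightarrow> m \<in> QoI D) \<Longrightarrow> m \<in> A \<Longrightarrow> m \<subseteq> qjoin D A"
  unfolding qjoin_def using subset_tc[of "\<Union>A" D] QoI_subset_LoI by blast

lemma qjoin_qoi1:
  assumes "\<And>m. m \<in> A \<Longrightarrow> m \<in> qoi1 D" and "A \<noteq> {}"
  shows "qjoin D A \<in> qoi1 D"
proof -
  have "qjoin D A \<in> QoI D"
    unfolding qjoin_def using assms by (intro tc_QoI) (auto simp: qoi1_iff QoI_def)
  moreover from assms(2) obtain m where "m \<in> A" by blast
  ultimately show ?thesis using assms(1) qjoin_upper[of A D m] by (auto simp: qoi1_iff)
qed

text \<open>The factor \<open>D \<times> D\<close> takes care of empty \<open>V\<close>, where the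
  intersection of the family alone would be \<open>UNIV\<close> and not the member of the
  unit.\<close>

lemma finprod_memI:
  assumes "finite V" and "\<And>v. v \<in> V \<Longrightarrow> \<Gamma> v \<in> QoI D" and "\<And>v. v \<in> V \<Longrightarrow> P v \<in> \<Gamma> v"
  shows "D \<times> D \<inter> (\<Inter>v\<in>V. P v) \<in> (\<Otimes>\<^bsub>qoi D\<^esub> v\<in>V. \<Gamma> v)"
  using assms
proof (induction V)
  case empty
  show ?case using comm_monoid.finprod_empty[OF comm_monoid_qoi, of D \<Gamma>] by simp
next
  case (insert v V)
  interpret comm_monoid "qoi D" by (rule comm_monoid_qoi)
  have G: "\<Gamma> \<in> V \<rightarrow> carrier (qoi D)" "\<Gamma> v \<in> carrier (qoi D)" using insert.prems by auto
  have "P v \<inter> (D \<times> D \<inter> (\<Inter>v\<in>V. P v)) \<in> qtensor D (\<Gamma> v) (\<Otimes>\<^bsub>qoi D\<^esub> v\<in>V. \<Gamma> v)"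
    using insert finprod_closed[OF G(1)] by (intro qtensorI) auto
  then show ?case using finprod_insert[OF insert.hyps G] by (simp add: Int_left_commute)
qed

lemma finprod_qoi1:
  assumes "finite V" and "\<And>v. v \<in> V \<Longrightarrow> \<Gamma> v \<in> qoi1 D"
  shows "(\<Otimes>\<^bsub>qoi D\<^esub> v\<in>V. \<Gamma> v) \<in> qoi1 D"
proof -
  have "(\<Otimes>\<^bsub>qoi D\<^esub> v\<in>V. \<Gamma> v) \<in> QoI D"
    using comm_monoid.finprod_closed[OF comm_monoid_qoi, of \<Gamma> V D] assms(2)
    by (auto simp: qoi1_iff)
  moreover have "D \<times> D \<inter> (\<Inter>v\<in>V. D \<times> D) = D \<times> D" by blast
  ultimately show ?thesis
    using finprod_memI[of V \<Gamma> D "\<lambda>_. D \<times> D"] assms by (simp add: qoi1_iff)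
qed

lemma pow_closed: "t \<in> QoI D \<Longrightarrow> t [^]\<^bsub>qoi D\<^esub> (n::nat) \<in> QoI D"
  using monoid.nat_pow_closed[OF comm_monoid.axioms(1)[OF comm_monoid_qoi], of t D n] by simp

text \<open>The factors may be different members of \<open>t\<close>. In a loop, \<open>T k\<close>
  will mediate the guard after \<open>k\<close> iterations.\<close>

lemma pow_memI:
  fixes n :: nat
  assumes "t \<in> QoI D" and "\<And>k. k < n \<Longrightarrow> T k \<in> t"
  shows "D \<times> D \<inter> (\<Inter>k<n. T k) \<in> t [^]\<^bsub>qoi D\<^esub> n"
  using assms(2)
proof (induction n)
  case (Suc n)
  then have "(D \<times> D \<inter> (\<Inter>k<n. T k)) \<inter> T n \<in> qtensor D (t [^]\<^bsub>qoi D\<^esub> n) t"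
    by (intro qtensorI pow_closed assms(1)) auto
  then show ?case by (simp add: lessThan_Suc Int_ac nat_pow_def)
qed (simp add: nat_pow_def)

lemma qstar_qoi1: "t \<in> qoi1 D \<Longrightarrow> qstar D t \<in> qoi1 D"
  unfolding qstar_def
proof (rule qjoin_qoi1)
  fix m assume t: "t \<in> qoi1 D" and m: "m \<in> range (\<lambda>n::nat. t [^]\<^bsub>qoi D\<^esub> n)"
  then obtain n :: nat where n: "m = t [^]\<^bsub>qoi D\<^esub> n" by blast
  have "D \<times> D \<inter> (\<Inter>k<n. D \<times> D) = D \<times> D" by blast
  with t n pow_closed[of t D n] pow_memI[of t D n "\<lambda>_. D \<times> D"] show "m \<in> qoi1 D" by (simp add: qoi1_iff)
qed simp

lemma qstar_memI:
  fixes n :: nat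
  assumes "t \<in> QoI D" and "\<And>k. k < n \<Longrightarrow> T k \<in> t"
  shows "D \<times> D \<inter> (\<Inter>k<n. T k) \<in> qstar D t"
proof -
  have "t [^]\<^bsub>qoi D\<^esub> n \<subseteq> qstar D t"
    unfolding qstar_def by (rule qjoin_upper) (auto intro: pow_closed assms(1))
  with pow_memI[of t D n T] assms show ?thesis by blast
qed

lemma texp_qoi1: "\<Gamma> \<in> envs D \<Longrightarrow> texp D fv E (\<Gamma> :: 'v::finite \<Rightarrow> 'd rel set) \<in> qoi1 D"
  unfolding texp_def by (rule finprod_qoi1) (auto simp: envs_def)

section \<open>Mediators\<close>

lemma mediates_mono: "mediates h A \<Longrightarrow> A \<subseteq> B \<Longrightarrow> mediates h B"
  unfolding mediates_def by blast

lemma mediates_restrict: "mediates h A \<Longrightarrow> h' \<subseteq>\<^sub>m h \<Longrightarrow> mediates h' A"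
  unfolding mediates_def map_le_def by (metis domIff)

text \<open>The common core of branches and loops. The relation \<open>T\<close> fixes the index
  \<open>K\<close>, that is, the branch taken or the number of iterations, and inside a cell of
  \<open>T\<close> with index \<open>i\<close> the relation \<open>P i\<close> mediates the
  outcome.\<close>

lemma mediates_glue:
  fixes h :: "'d \<Rightarrow> 'b option"
  assumes A: "A \<in> QoI D" and B: "B \<in> QoI D" and T: "T \<in> A" and P: "\<And>i. P i \<in> B"
    and K: "\<And>d d'. (d, d') \<in> T \<Longrightarrow> d \<in> dom h \<Longrightarrow> d' \<in> dom h \<Longrightarrow> K d = K d'"
    and h: "\<And>d d'. (d, d') \<in> T \<Longrightarrow> (d, d') \<in> P (K d) \<Longrightarrow> d \<in> dom h \<Longrightarrow> d' \<in> dom h \<Longrightarrow> h d = h d'"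
  shows "mediates h (qtensor D A B)"
proof -
  have TL: "T \<in> LoI D" using T A by (auto simp: QoI_def)
  then have eqT: "equiv D T" by (simp add: LoI_def)
  \<comment> \<open>\<open>K\<close> is only constant on the points of a cell where \<open>h\<close> is defined, so it is read off at such a
    point; on a cell without one the choice is irrelevant.\<close>
  define R where "R d = P (K (SOME e. e \<in> T `` {d} \<inter> dom h))" for d
  have R: "R d = P (K d)" if "d \<in> dom h" "d \<in> D" for d
  proof -
    have "d \<in> T `` {d} \<inter> dom h" using equiv_class_self[OF eqT that(2)] that(1) by simp
    then have "(SOME e. e \<in> T `` {d} \<inter> dom h) \<in> T `` {d} \<inter> dom h" by (rule someI)
    then have "K d = K (SOME e. e \<in> T `` {d} \<inter> dom h)" using K[of d] that(1) by blast
    then show ?thesis by (simp only: R_def)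
  qed
  have PL: "P i \<in> LoI D" for i using P B by (auto simp: QoI_def)
  have G: "glue T R \<in> LoI D"
    by (rule glue_LoI[OF TL]) (auto simp: R_def PL equiv_class_eq[OF eqT])
  \<comment> \<open>The cell of the glued relation at \<open>x\<close> is a cell of the single meet
    \<open>T \<inter> R x\<close>, so the glued relation is a mix of
    \<open>meets A B\<close>.\<close>
  have "\<exists>Z\<in>meets A B. Z `` {x} = glue T R `` {x}" for x
  proof -
    have "(T \<inter> R x) `` {x} = glue T R `` {x}" by (auto simp: glue_def)
    moreover have "T \<inter> R x \<in> meets A B" using T P by (auto simp: R_def)
    ultimately show ?thesis by blast
  qed
  then have "glue T R \<in> qtensor D A B"
    unfolding qtensor_def using A B G
    by (intro tcI[where S = "glue T R"] meets_LoI QoI_subset_LoI subset_refl)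
  moreover have "h d = h d'" if "(d, d') \<in> glue T R" "d \<in> dom h" "d' \<in> dom h" for d d'
  proof -
    have dd: "(d, d') \<in> T" "(d, d') \<in> R d" using that(1) by (auto simp: glue_def)
    then have "d \<in> D" using LoI_subset[OF TL] by blast
    with dd R h that show ?thesis by metis
  qed
  ultimately show ?thesis unfolding mediates_def by blast
qed

section \<open>Observations of store-valued partial functions\<close>

lemma mediates_map_iff:
  "mediates (map_option f \<circ> h) A \<longleftrightarrow>
    (\<exists>P\<in>A. \<forall>d d' s s'. (d, d') \<in> P \<longrightarrow> h d = Some s \<longrightarrow> h d' = Some s' \<longrightarrow> f s = f s')"
  unfolding mediates_def by (intro bex_cong refl) (force simp: dom_def)

text \<open>Legality for one store-valued partial function in place of a family of components. This
  form applies equally to the stores reached after part of a command has run, so it can be carried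
  through an induction.\<close>

definition store_legal :: "('d \<Rightarrow> ('v \<Rightarrow> 'a) option) \<Rightarrow> ('v \<Rightarrow> 'd rel set) \<Rightarrow> bool" where
  "store_legal h \<Gamma> \<longleftrightarrow> (\<forall>v. mediates (map_option (\<lambda>s. s v) \<circ> h) (\<Gamma> v))"

lemma store_legal_mono: "store_legal h \<Gamma> \<Longrightarrow> \<Gamma> \<le> \<Gamma>' \<Longrightarrow> store_legal h \<Gamma>'"
  unfolding store_legal_def le_fun_def by (blast intro: mediates_mono)

lemma map_option_map_le: "h' \<subseteq>\<^sub>m h \<Longrightarrow> map_option f \<circ> h' \<subseteq>\<^sub>m map_option f \<circ> h"
  by (auto simp: map_le_def dom_def)

lemma store_legal_restrict: "store_legal h \<Gamma> \<Longrightarrow> h' \<subseteq>\<^sub>m h \<Longrightarrow> store_legal h' \<Gamma>"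
  unfolding store_legal_def by (blast intro: mediates_restrict map_option_map_le)

text \<open>Points related by the relations of all variables in \<open>V\<close> agree on
  \<open>V\<close>, hence on anything determined by \<open>V\<close>. This serves expressions, with
  \<open>V\<close> the free variables, and the final observation, with \<open>V\<close> the set
  \<open>W\<close>.\<close>

lemma mediates_tuple:
  assumes "finite V" and "\<And>v. v \<in> V \<Longrightarrow> \<Gamma> v \<in> QoI D"
    and "\<And>v. v \<in> V \<Longrightarrow> mediates (map_option (\<lambda>s. s v) \<circ> h) (\<Gamma> v)"
    and f: "\<And>s s'. (\<forall>v\<in>V. s v = s' v) \<Longrightarrow> f s = f s'"
  shows "mediates (map_option f \<circ> h) (\<Otimes>\<^bsub>qoi D\<^esub> v\<in>V. \<Gamma> v)"
proof -
  obtain P where P: "\<And>v. v \<in> V \<Longrightarrow> P v \<in> \<Gamma> v"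
    "\<And>v d d' s s'. v \<in> V \<Longrightarrow> (d, d') \<in> P v \<Longrightarrow> h d = Some s \<Longrightarrow> h d' = Some s' \<Longrightarrow> s v = s' v"
    using assms(3) unfolding mediates_map_iff by metis
  show ?thesis unfolding mediates_map_iff
  proof (rule bexI)
    show "D \<times> D \<inter> (\<Inter>v\<in>V. P v) \<in> (\<Otimes>\<^bsub>qoi D\<^esub> v\<in>V. \<Gamma> v)"
      by (rule finprod_memI) (use assms P in auto)
    show "\<forall>d d' s s'. (d, d') \<in> D \<times> D \<inter> (\<Inter>v\<in>V. P v) \<longrightarrow> h d = Some s \<longrightarrow> h d' = Some s'
        \<longrightarrow> f s = f s'"
      by (intro allI impI f ballI, rule P(2)) auto
  qed
qed

text \<open>Since the components share one domain, the projection of \<open>hat g\<close> to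
  \<open>v\<close> is \<open>g v\<close> itself.\<close>

lemma legal_hat:
  assumes "mediator_family D g" and "legal g \<Gamma>"
  shows "store_legal (hat g) \<Gamma>"
proof -
  obtain A where A: "\<And>v. dom (g v) = A" using assms(1) by (auto simp: mediator_family_def)
  have "map_option (\<lambda>s. s v) \<circ> hat g = g v" for v
  proof
    fix d
    show "(map_option (\<lambda>s. s v) \<circ> hat g) d = g v d"
    proof (cases "d \<in> A")
      case True
      then have "g v d \<noteq> None" using A[of v] by blast
      with True show ?thesis by (auto simp: hat_def A)
    next
      case False
      then have "g v d = None" using A[of v] by blast
      with False show ?thesis by (simp add: hat_def A)
    qed
  qed
  with assms(2) show ?thesis by (simp add: store_legal_def legal_def)
qed

lemma mediates_exp:
  fixes \<Gamma> :: "'v::finite \<Rightarrow> 'd rel set"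
  assumes "fv_sound fv ev" "\<Gamma> \<in> envs D" "store_legal h \<Gamma>"
  shows "mediates (map_option (ev E) \<circ> h) (texp D fv E \<Gamma>)"
  unfolding texp_def
  by (rule mediates_tuple)
    (use assms in \<open>auto simp: store_legal_def envs_def qoi1_iff fv_sound_def\<close>)

section \<open>Loops\<close>

text \<open>The store after exactly \<open>n\<close> passes, defined only if the guard held before
  each of them. The guard is not tested after the last pass, so a run that stops and one that goes
  on can be compared at the same count.\<close>

primrec iterate :: "('s \<Rightarrow> bool) \<Rightarrow> ('s \<Rightarrow> 's option) \<Rightarrow> nat \<Rightarrow> 's \<Rightarrow> 's option" where
  "iterate b f 0 s = Some s"
| "iterate b f (Suc n) s = (if b s then Option.bind (f s) (iterate b f n) else None)"

text \<open>By fixed-point induction for partial correctness, which speaks only of defined results: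
  each unfolding of the loop equation adds one pass.\<close>

lemma while_sem_iterate:
  "while_sem b f s = Some s' \<Longrightarrow> \<exists>n. iterate b f n s = Some s' \<and> \<not> b s'"
proof (erule while_sem.raw_induct[where P = "\<lambda>b f s s'. \<exists>n. iterate b f n s = Some s' \<and> \<not> b s'",
      rotated])
  fix w b f s s'
  assume IH: "\<And>b f s s'. w b f s = Some s' \<Longrightarrow> \<exists>n. iterate b f n s = Some s' \<and> \<not> b s'"
    and w: "(if b s then Option.bind (f s) (w b f) else Some s) = Some s'"
  show "\<exists>n. iterate b f n s = Some s' \<and> \<not> b s'"
  proof (cases "b s")
    case True
    with w obtain u where u: "f s = Some u" "w b f u = Some s'" by (auto simp: bind_eq_Some_conv)
    with IH obtain n where "iterate b f n u = Some s'" "\<not> b s'" by blast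
    with u True have "iterate b f (Suc n) s = Some s' \<and> \<not> b s'" by simp
    then show ?thesis ..
  next
    case False
    with w have "iterate b f 0 s = Some s' \<and> \<not> b s'" by auto
    then show ?thesis ..
  qed
qed

text \<open>This separates runs of different lengths: at the count where the shorter one stops, the
  guard of the longer one is still true.\<close>

lemma iterate_less:
  "iterate b f n s = Some u \<Longrightarrow> m < n \<Longrightarrow> \<exists>w. iterate b f m s = Some w \<and> b w"
proof (induction n arbitrary: m s)
  case (Suc n)
  then show ?case by (cases m) (auto simp: bind_eq_Some_conv split: if_splits)
qed simp

lemma iterate_preserves:
  assumes "iterate b f n s = Some u" and "\<And>s s'. f s = Some s' \<Longrightarrow> s' x = s x"
  shows "u x = s x"
  using assms(1)
proof (induction n arbitrary: s)
  case (Suc n)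
  then show ?case using assms(2) by (fastforce simp: bind_eq_Some_conv split: if_splits)
qed simp

lemma while_sem_preserves:
  "while_sem b f s = Some s' \<Longrightarrow> (\<And>s s'. f s = Some s' \<Longrightarrow> s' x = s x) \<Longrightarrow> s' x = s x"
  using while_sem_iterate[of b f s s'] iterate_preserves[of b f _ s s' x] by blast

lemma iterate_legal:
  assumes step: "\<And>h. store_legal h \<Gamma> \<Longrightarrow> store_legal (f \<circ>\<^sub>m h) \<Gamma>" and "store_legal h \<Gamma>"
  shows "store_legal (iterate b f n \<circ>\<^sub>m h) \<Gamma>"
  using assms(2)
proof (induction n arbitrary: h)
  case 0
  have "iterate b f 0 \<circ>\<^sub>m h = h" by (auto simp: map_comp_def fun_eq_iff split: option.split)
  with 0 show ?case by (simp only:)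
next
  case (Suc n)
  \<comment> \<open>The first pass is split off and attached to \<open>h\<close>. Filtering by the
    guard only shrinks the domain of \<open>f\<close> after \<open>h\<close>, which preserves
    mediation.\<close>
  let ?h = "(\<lambda>s. if b s then f s else None) \<circ>\<^sub>m h"
  have "?h \<subseteq>\<^sub>m f \<circ>\<^sub>m h"
    unfolding map_le_def
  proof
    show "?h d = (f \<circ>\<^sub>m h) d" if "d \<in> dom ?h" for d
      using that by (cases "h d") (simp_all add: dom_def split: if_splits)
  qed
  with step[OF Suc.prems] have "store_legal ?h \<Gamma>" by (rule store_legal_restrict)
  then have "store_legal (iterate b f n \<circ>\<^sub>m ?h) \<Gamma>" by (rule Suc.IH)
  moreover have "iterate b f n \<circ>\<^sub>m ?h = iterate b f (Suc n) \<circ>\<^sub>m h"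
    by (auto simp: map_comp_def fun_eq_iff Option.bind_def split: option.split)
  ultimately show ?case by (simp only:)
qed

text \<open>If \<open>K d < K d'\<close>, then after \<open>K d\<close> passes the guard is false
  for \<open>d\<close> and true for \<open>d'\<close>, so a guard relation separates them. Secrets
  related by all guard relations thus make equally many passes, and the relation for that number of
  passes mediates the final value of \<open>x\<close>.\<close>

lemma while_mediates:
  assumes D: "finite D" and t: "t \<in> QoI D" and G: "\<Gamma> x \<in> QoI D"
    and step: "\<And>h. store_legal h \<Gamma> \<Longrightarrow> store_legal (f \<circ>\<^sub>m h) \<Gamma>"
    and guard: "\<And>h. store_legal h \<Gamma> \<Longrightarrow> mediates (map_option b \<circ> h) t"
    and h: "store_legal h \<Gamma>"
  shows "mediates (map_option (\<lambda>s. s x) \<circ> (while_sem b f \<circ>\<^sub>m h)) (qtensor D (qstar D t) (\<Gamma> x))"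
proof -
  let ?h = "\<lambda>n. iterate b f n \<circ>\<^sub>m h"
  let ?k = "map_option (\<lambda>s. s x) \<circ> (while_sem b f \<circ>\<^sub>m h)"
  note legal = iterate_legal[OF step h, of b]
  have "\<forall>n. \<exists>P\<in>\<Gamma> x. \<forall>d d' s s'. (d, d') \<in> P \<longrightarrow> ?h n d = Some s \<longrightarrow> ?h n d' = Some s'
      \<longrightarrow> s x = s' x"
    using legal unfolding store_legal_def mediates_map_iff by blast
  then obtain P where P: "\<And>n. P n \<in> \<Gamma> x"
    "\<And>n d d' s s'. (d, d') \<in> P n \<Longrightarrow> ?h n d = Some s \<Longrightarrow> ?h n d' = Some s' \<Longrightarrow> s x = s' x"
    by metis
  have "\<forall>n. \<exists>T\<in>t. \<forall>d d' s s'. (d, d') \<in> T \<longrightarrow> ?h n d = Some s \<longrightarrow> ?h n d' = Some s'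
      \<longrightarrow> b s = b s'"
    using guard[OF legal] unfolding mediates_map_iff by blast
  then obtain T where T: "\<And>n. T n \<in> t"
    "\<And>n d d' s s'. (d, d') \<in> T n \<Longrightarrow> ?h n d = Some s \<Longrightarrow> ?h n d' = Some s' \<Longrightarrow> b s = b s'"
    by metis
  \<comment> \<open>\<open>K d\<close> will be the number of passes made from \<open>d\<close>, and
    an arbitrary number where there is no final store.\<close>
  have "\<forall>d. \<exists>n. \<forall>s'. (while_sem b f \<circ>\<^sub>m h) d = Some s' \<longrightarrow> ?h n d = Some s' \<and> \<not> b s'"
    by (auto simp: map_comp_Some_iff) (metis option.inject while_sem_iterate)
  then obtain K where K:
    "\<And>d s'. (while_sem b f \<circ>\<^sub>m h) d = Some s' \<Longrightarrow> ?h (K d) d = Some s' \<and> \<not> b s'"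
    by metis
  \<comment> \<open>Finiteness of \<open>D\<close> bounds the passes for all secrets at once, so
    finitely many guard relations suffice for \<open>U\<close> and it lies in a finite power of
    \<open>t\<close>.\<close>
  obtain N where N: "\<And>d. d \<in> D \<Longrightarrow> K d < N"
    using D finite_nat_set_iff_bounded[of "K ` D"] by auto
  define U where "U = D \<times> D \<inter> (\<Inter>k<N. T k)"
  have dom: "d \<in> dom ?k \<Longrightarrow> \<exists>s. (while_sem b f \<circ>\<^sub>m h) d = Some s" for d
    unfolding dom_def by (cases "(while_sem b f \<circ>\<^sub>m h) d") simp_all
  have less: "\<not> K d < K d'"
    if dd: "(d, d') \<in> U" "d \<in> dom ?k" "d' \<in> dom ?k" for d d'
  proof
    assume lt: "K d < K d'"
    obtain s s' where s: "(while_sem b f \<circ>\<^sub>m h) d = Some s" "(while_sem b f \<circ>\<^sub>m h) d' = Some s'"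
      using dom dd by meson
    obtain s0 where s0: "h d' = Some s0" "iterate b f (K d') s0 = Some s'"
      using K[OF s(2)] by (auto simp: map_comp_Some_iff)
    then obtain w where w: "?h (K d) d' = Some w" "b w"
      using iterate_less[OF s0(2) lt] by auto
    have "(d, d') \<in> T (K d)" using that N by (auto simp: U_def)
    then have "b s = b w" using K[OF s(1)] w T(2) by blast
    then show False using K[OF s(1)] w by simp
  qed
  \<comment> \<open>\<open>less\<close> excludes one strict inequality between \<open>K d\<close>
    and \<open>K d'\<close>; symmetry of \<open>U\<close> excludes the other.\<close>
  have sym: "(d', d) \<in> U" if "(d, d') \<in> U" for d d'
  proof -
    have "sym (T k)" for k using T t by (auto simp: QoI_def LoI_def equiv_def)
    then have "(d', d) \<in> T k" if "k < N" for k
      using \<open>(d, d') \<in> U\<close> that by (auto simp: U_def intro: symD[of "T k"])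
    then show ?thesis using that by (simp add: U_def)
  qed
  show ?thesis
  proof (rule mediates_glue[where T = U and P = P and K = K])
    show "qstar D t \<in> QoI D"
      unfolding qstar_def qjoin_def
      by (intro tc_QoI) (auto dest: QoI_subset_LoI[OF pow_closed[OF t], THEN subsetD])
    show "U \<in> qstar D t" unfolding U_def by (rule qstar_memI[OF t T(1)])
    show "K d = K d'" if "(d, d') \<in> U" "d \<in> dom ?k" "d' \<in> dom ?k" for d d'
      using less[of d d'] less[of d' d] sym that by force
    then show "?k d = ?k d'"
      if dd: "(d, d') \<in> U" "(d, d') \<in> P (K d)" "d \<in> dom ?k" "d' \<in> dom ?k" for d d'
    proof -
      obtain s s' where s: "(while_sem b f \<circ>\<^sub>m h) d = Some s" "(while_sem b f \<circ>\<^sub>m h) d' = Some s'"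
        using dom dd by meson
      have "K d = K d'" using less[of d d'] less[of d' d] sym that by force
      then have "s x = s' x" using K[OF s(1)] K[OF s(2)] P(2) that by metis
      with s show ?thesis by simp
    qed
  qed (use G P in auto)
qed

section \<open>Soundness\<close>

lemma sem_unassigned:
  "sem ev tst C s = Some s' \<Longrightarrow> x \<notin> asgn C \<Longrightarrow> s' x = s x"
proof (induction C arbitrary: s s')
  case (Seq C1 C2)
  from Seq.prems(1) obtain u where "sem ev tst C1 s = Some u" "sem ev tst C2 u = Some s'"
    by (auto simp: bind_eq_Some_conv)
  with Seq.IH(1)[of s u] Seq.IH(2)[of u s'] Seq.prems(2) show ?case by simp
next
  case (While E C)
  then show ?case by (auto elim: while_sem_preserves)
qed (auto split: if_splits)

lemma typing_qoi1_envs: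
  "typing D fv p \<Gamma> C \<Gamma>' \<Longrightarrow> p \<in> qoi1 D \<and> \<Gamma> \<in> envs D \<and> \<Gamma>' \<in> envs D"
proof (induction rule: typing.induct)
  case (T_Assign p \<Gamma> x E)
  then show ?case using texp_qoi1[of \<Gamma> D fv E]
    by (auto simp: envs_def Pi_iff intro: qtensor_qoi1)
next
  case (T_If p \<Gamma> t E C1 \<Gamma>1 C2 \<Gamma>2)
  then show ?case using texp_qoi1[of \<Gamma> D fv E]
    by (auto simp: envs_def Pi_iff intro!: qtensor_qoi1 qjoin_qoi1)
next
  case (T_While p \<Gamma> t E C)
  then show ?case using texp_qoi1[of \<Gamma> D fv E]
    by (auto simp: envs_def Pi_iff intro!: qtensor_qoi1 qstar_qoi1)
qed auto

text \<open>The domain of \<open>f\<close> after \<open>h\<close> lies inside that of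
  \<open>h\<close>, and there \<open>x\<close> keeps its value, so the old relation still
  mediates.\<close>

lemma unchanged_mediates:
  assumes "mediates (map_option (\<lambda>s. s x) \<circ> h) A" and "\<And>s s'. f s = Some s' \<Longrightarrow> s' x = s x"
  shows "mediates (map_option (\<lambda>s. s x) \<circ> (f \<circ>\<^sub>m h)) A"
proof -
  obtain P where P: "P \<in> A"
    "\<And>d d' s s'. (d, d') \<in> P \<Longrightarrow> h d = Some s \<Longrightarrow> h d' = Some s' \<Longrightarrow> s x = s' x"
    using assms(1) unfolding mediates_map_iff by metis
  show ?thesis unfolding mediates_map_iff
  proof (intro bexI[OF _ P(1)] allI impI)
    fix d d' u u'
    assume "(d, d') \<in> P" "(f \<circ>\<^sub>m h) d = Some u" "(f \<circ>\<^sub>m h) d' = Some u'"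
    then show "u x = u' x" using P(2)[of d d'] by (auto simp: map_comp_Some_iff dest!: assms(2))
  qed
qed

text \<open>Inside each cell of the guard relation \<open>T\<close> all outcomes come from the same
  branch, and the relation for that branch mediates them.\<close>

lemma cond_mediates:
  assumes t: "t \<in> QoI D" and G: "\<Gamma>1 x \<in> qoi1 D" "\<Gamma>2 x \<in> qoi1 D"
    and guard: "mediates (map_option b \<circ> h) t"
    and f1: "\<And>h. store_legal h \<Gamma> \<Longrightarrow> store_legal (f1 \<circ>\<^sub>m h) \<Gamma>1"
    and f2: "\<And>h. store_legal h \<Gamma> \<Longrightarrow> store_legal (f2 \<circ>\<^sub>m h) \<Gamma>2"
    and h: "store_legal h \<Gamma>"
  shows "mediates (map_option (\<lambda>s. s x) \<circ> ((\<lambda>s. if b s then f1 s else f2 s) \<circ>\<^sub>m h))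
    (qtensor D t (qjoin D {\<Gamma>1 x, \<Gamma>2 x}))"
    (is "mediates (_ \<circ> ?F) _")
proof -
  obtain T where T: "T \<in> t"
    "\<And>d d' s s'. (d, d') \<in> T \<Longrightarrow> h d = Some s \<Longrightarrow> h d' = Some s' \<Longrightarrow> b s = b s'"
    using guard unfolding mediates_map_iff by metis
  obtain P1 where P1: "P1 \<in> \<Gamma>1 x"
    "\<And>d d' s s'. (d, d') \<in> P1 \<Longrightarrow> (f1 \<circ>\<^sub>m h) d = Some s \<Longrightarrow> (f1 \<circ>\<^sub>m h) d' = Some s' \<Longrightarrow> s x = s' x"
    using f1[OF h] unfolding store_legal_def mediates_map_iff by metis
  obtain P2 where P2: "P2 \<in> \<Gamma>2 x"
    "\<And>d d' s s'. (d, d') \<in> P2 \<Longrightarrow> (f2 \<circ>\<^sub>m h) d = Some s \<Longrightarrow> (f2 \<circ>\<^sub>m h) d' = Some s' \<Longrightarrow> s x = s' x"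
    using f2[OF h] unfolding store_legal_def mediates_map_iff by metis
  have upper: "\<Gamma>1 x \<subseteq> qjoin D {\<Gamma>1 x, \<Gamma>2 x}" "\<Gamma>2 x \<subseteq> qjoin D {\<Gamma>1 x, \<Gamma>2 x}"
    by (rule qjoin_upper; use G in \<open>auto simp: qoi1_iff\<close>)+
  \<comment> \<open>The index is the branch taken; indices are compared only where the outcome, and
    hence \<open>h\<close>, is defined.\<close>
  define K where "K d = b (the (h d))" for d
  show ?thesis
  proof (rule mediates_glue[where T = T and P = "\<lambda>c. if c then P1 else P2" and K = K])
    show "qjoin D {\<Gamma>1 x, \<Gamma>2 x} \<in> QoI D"
      using qjoin_qoi1[of "{\<Gamma>1 x, \<Gamma>2 x}" D] G by (auto simp: qoi1_iff)
    show "(if c then P1 else P2) \<in> qjoin D {\<Gamma>1 x, \<Gamma>2 x}" for c using upper P1 P2 by auto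
    fix d d' assume dd: "(d, d') \<in> T" "d \<in> dom (map_option (\<lambda>s. s x) \<circ> ?F)"
      "d' \<in> dom (map_option (\<lambda>s. s x) \<circ> ?F)"
    then obtain s s' u u' where s: "h d = Some s" "h d' = Some s'"
      and u: "?F d = Some u" "?F d' = Some u'" by (auto simp: map_comp_Some_iff)
    have b: "b s = b s'" using dd s T by blast
    then show "K d = K d'" by (simp add: K_def s)
    assume P: "(d, d') \<in> (if K d then P1 else P2)"
    have "u x = u' x"
    proof (cases "b s")
      case True
      with b s u have "(f1 \<circ>\<^sub>m h) d = Some u" "(f1 \<circ>\<^sub>m h) d' = Some u'" by auto
      with P True s show ?thesis using P1(2) by (simp add: K_def)
    next
      case False
      with b s u have "(f2 \<circ>\<^sub>m h) d = Some u" "(f2 \<circ>\<^sub>m h) d' = Some u'" by auto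
      with P False s show ?thesis using P2(2) by (simp add: K_def)
    qed
    with u show "(map_option (\<lambda>s. s x) \<circ> ?F) d = (map_option (\<lambda>s. s x) \<circ> ?F) d'" by simp
  qed (use t T in auto)
qed

lemma mediates_guard:
  fixes \<Gamma> :: "'v::finite \<Rightarrow> 'd rel set"
  assumes "fv_sound fv ev" "\<Gamma> \<in> envs D" "store_legal h \<Gamma>"
  shows "mediates (map_option (\<lambda>s. tst (ev E s)) \<circ> h) (texp D fv E \<Gamma>)"
  using mediates_exp[OF assms, of E] unfolding mediates_map_iff by metis

text \<open>At branches and loops the bound comes from the commands inside, because \<open>p\<close>
  lies below \<open>p\<close> tensored with the guard. The unassigned case belongs to the induction
  since a sequence may assign \<open>x\<close> in its first command only.\<close>

lemma typing_asgn:
  "typing D fv p \<Gamma> C \<Gamma>' \<Longrightarrow> if x \<in> asgn C then p \<subseteq> \<Gamma>' x else \<Gamma> x \<subseteq> \<Gamma>' x"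
proof (induction rule: typing.induct)
  case (T_Assign p \<Gamma> y E)
  then have "p \<subseteq> qtensor D p (texp D fv E \<Gamma>)"
    by (intro qtensor_upper1 texp_qoi1) (simp add: qoi1_iff)
  then show ?case by auto
next
  case (T_Seq p \<Gamma> C1 \<Gamma>'' C2 \<Gamma>')
  then show ?case by (auto split: if_splits)
next
  case (T_If p \<Gamma> t E C1 \<Gamma>1 C2 \<Gamma>2)
  have t: "t \<in> qoi1 D" using T_If texp_qoi1[of \<Gamma> D fv E] by simp
  have G: "\<Gamma>1 x \<in> qoi1 D" "\<Gamma>2 x \<in> qoi1 D"
    using typing_qoi1_envs[OF T_If(4)] typing_qoi1_envs[OF T_If(5)] by (auto simp: envs_def)
  then have "qjoin D {\<Gamma>1 x, \<Gamma>2 x} \<in> QoI D"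
    using qjoin_qoi1[of "{\<Gamma>1 x, \<Gamma>2 x}" D] by (auto simp: qoi1_iff)
  then have "qjoin D {\<Gamma>1 x, \<Gamma>2 x} \<subseteq> qtensor D t (qjoin D {\<Gamma>1 x, \<Gamma>2 x})"
    by (rule qtensor_upper2[OF t])
  moreover have "\<Gamma>1 x \<subseteq> qjoin D {\<Gamma>1 x, \<Gamma>2 x}" "\<Gamma>2 x \<subseteq> qjoin D {\<Gamma>1 x, \<Gamma>2 x}"
    by (rule qjoin_upper; use G in \<open>auto simp: qoi1_iff\<close>)+
  moreover have "p \<subseteq> qtensor D p t" using T_If t by (intro qtensor_upper1) (auto simp: qoi1_iff)
  ultimately show ?case using T_If.IH by (auto split: if_splits)
next
  case (T_While p \<Gamma> t E C)
  have t: "t \<in> qoi1 D" using T_While texp_qoi1[of \<Gamma> D fv E] by simp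
  have "p \<subseteq> qtensor D p t" using T_While t by (intro qtensor_upper1) (auto simp: qoi1_iff)
  moreover have "\<Gamma> x \<subseteq> qtensor D (qstar D t) (\<Gamma> x)"
    using T_While by (intro qtensor_upper2 qstar_qoi1 t) (auto simp: envs_def qoi1_iff)
  ultimately show ?case using T_While.IH by (auto split: if_splits dest: subset_trans)
next
  case (T_Sub p \<Gamma> C \<Gamma>1 p' \<Gamma>' \<Gamma>2)
  then show ?case by (force simp: le_fun_def split: if_splits)
qed auto

text \<open>\<open>h\<close> is arbitrary so that the hypothesis for the second command of a
  sequence applies to the output of the first, and the one for a loop body to every iterate.\<close>

lemma typing_legal:
  fixes \<Gamma> :: "'v::finite \<Rightarrow> 'd rel set"
  assumes D: "finite D" and fv: "fv_sound fv ev"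
  shows "typing D fv p \<Gamma> C \<Gamma>' \<Longrightarrow> store_legal h \<Gamma> \<Longrightarrow> store_legal (sem ev tst C \<circ>\<^sub>m h) \<Gamma>'"
proof (induction arbitrary: h rule: typing.induct)
  case (T_Skip p \<Gamma>)
  then show ?case using unchanged_mediates[of _ h _ Some] by (auto simp: store_legal_def)
next
  case (T_Assign p \<Gamma> x E)
  let ?t = "texp D fv E \<Gamma>" and ?h = "sem ev tst (Assign x E) \<circ>\<^sub>m h"
  have t: "?t \<in> QoI D" using texp_qoi1[of \<Gamma> D fv E] T_Assign by (auto simp: qoi1_iff)
  \<comment> \<open>The new value of \<open>x\<close> is the value of \<open>E\<close> in the old
    store; tensoring with \<open>p\<close> only enlarges the set of relations, as \<open>p\<close>
    is above the unit.\<close>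
  have "mediates (map_option (ev E) \<circ> h) (qtensor D p ?t)"
    using mediates_mono[OF mediates_exp[OF fv] qtensor_upper2] T_Assign t by blast
  moreover have eq: "map_option (\<lambda>s. s x) \<circ> ?h = map_option (ev E) \<circ> h"
  proof
    show "(map_option (\<lambda>s. s x) \<circ> ?h) d = (map_option (ev E) \<circ> h) d" for d
      by (cases "h d") simp_all
  qed
  ultimately have "mediates (map_option (\<lambda>s. s x) \<circ> ?h) (qtensor D p ?t)"
    by (simp only: eq)
  moreover have "mediates (map_option (\<lambda>s. s v) \<circ> ?h) (\<Gamma> v)" if "v \<noteq> x" for v
    using T_Assign that by (intro unchanged_mediates) (auto simp: store_legal_def)
  ultimately show ?case by (simp add: store_legal_def)
next
  case (T_Seq p \<Gamma> C1 \<Gamma>'' C2 \<Gamma>')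
  have "sem ev tst (Seq C1 C2) \<circ>\<^sub>m h = sem ev tst C2 \<circ>\<^sub>m (sem ev tst C1 \<circ>\<^sub>m h)"
    by (auto simp: map_comp_def fun_eq_iff Option.bind_def split: option.split)
  with T_Seq show ?case by simp
next
  case (T_If p \<Gamma> t E C1 \<Gamma>1 C2 \<Gamma>2)
  have t: "t \<in> QoI D" using T_If texp_qoi1[of \<Gamma> D fv E] by (auto simp: qoi1_iff)
  have guard: "mediates (map_option (\<lambda>s. tst (ev E s)) \<circ> h) t"
    unfolding T_If(3) by (rule mediates_guard[OF fv]) (use T_If in auto)
  have G: "\<Gamma>1 x \<in> qoi1 D" "\<Gamma>2 x \<in> qoi1 D" for x
    using typing_qoi1_envs[OF T_If(4)] typing_qoi1_envs[OF T_If(5)] by (auto simp: envs_def)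
  \<comment> \<open>Unassigned variables keep their type. The tensor bound is then derived for every
    \<open>x\<close>, and the case distinction in the final environment selects between the
    two.\<close>
  have "mediates (map_option (\<lambda>s. s x) \<circ> (sem ev tst (Cond E C1 C2) \<circ>\<^sub>m h)) (\<Gamma> x)"
    if "x \<notin> asgn C1 \<union> asgn C2" for x
  proof (rule unchanged_mediates)
    show "mediates (map_option (\<lambda>s. s x) \<circ> h) (\<Gamma> x)"
      using T_If.prems by (simp add: store_legal_def)
    show "s' x = s x" if "sem ev tst (Cond E C1 C2) s = Some s'" for s s'
      using sem_unassigned[OF that] \<open>x \<notin> asgn C1 \<union> asgn C2\<close> by simp
  qed
  moreover have "mediates (map_option (\<lambda>s. s x) \<circ> (sem ev tst (Cond E C1 C2) \<circ>\<^sub>m h))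
      (qtensor D t (qjoin D {\<Gamma>1 x, \<Gamma>2 x}))" for x
    unfolding sem.simps by (rule cond_mediates[OF t G guard T_If.IH T_If.prems])
  ultimately show ?case unfolding store_legal_def qoi_simps by presburger
next
  case (T_While p \<Gamma> t E C)
  have t: "t \<in> QoI D" using T_While texp_qoi1[of \<Gamma> D fv E] by (auto simp: qoi1_iff)
  have G: "\<Gamma> x \<in> QoI D" for x using T_While by (auto simp: envs_def qoi1_iff)
  have guard: "mediates (map_option (\<lambda>s. tst (ev E s)) \<circ> k) t" if "store_legal k \<Gamma>" for k
    unfolding T_While(3) by (rule mediates_guard[OF fv]) (use T_While that in auto)
  have "mediates (map_option (\<lambda>s. s x) \<circ> (sem ev tst (While E C) \<circ>\<^sub>m h)) (\<Gamma> x)"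
    if "x \<notin> asgn C" for x
  proof (rule unchanged_mediates)
    show "mediates (map_option (\<lambda>s. s x) \<circ> h) (\<Gamma> x)"
      using T_While.prems by (simp add: store_legal_def)
    show "s' x = s x" if "sem ev tst (While E C) s = Some s'" for s s'
      using sem_unassigned[OF that] \<open>x \<notin> asgn C\<close> by simp
  qed
  moreover have "mediates (map_option (\<lambda>s. s x) \<circ> (sem ev tst (While E C) \<circ>\<^sub>m h))
      (qtensor D (qstar D t) (\<Gamma> x))" for x
    unfolding sem.simps by (rule while_mediates[OF D t G T_While.IH guard T_While.prems])
  ultimately show ?case unfolding store_legal_def qoi_simps by presburger
next
  case (T_Sub p \<Gamma> C \<Gamma>1 p' \<Gamma>' \<Gamma>2)
  then show ?case by (blast intro: store_legal_mono)
qed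

theorem theorem1:
  fixes D :: "'d set"
    and fv :: "'e \<Rightarrow> 'v::finite set"
    and ev :: "'e \<Rightarrow> ('v \<Rightarrow> 'a) \<Rightarrow> 'a"
    and tst :: "'a \<Rightarrow> bool"
    and p :: "'d rel set"
    and \<Gamma> \<Gamma>' :: "'v \<Rightarrow> 'd rel set"
    and C :: "('v, 'e) com"
  assumes "finite D"
    and "fv_sound fv ev"
    and "p \<in> qoi1 D"
    and "\<Gamma> \<in> envs D"
    and "\<Gamma>' \<in> envs D"
    and "typing D fv p \<Gamma> C \<Gamma>'"
  shows "sem_judgement D ev tst p \<Gamma> C \<Gamma>' \<and>
    (\<forall>\<sigma> W Pol. \<sigma> \<in> envs D \<and> Pol \<in> qoi1 D \<and>
       (\<Otimes>\<^bsub>qoi D\<^esub> w \<in> W. \<Gamma>' w) \<subseteq> Pol \<and> \<sigma> \<le> \<Gamma> \<longrightarrow>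
       complies D ev tst C \<sigma> W Pol)"
proof -
  \<comment> \<open>If \<open>x\<close> were assigned, \<open>typing_asgn\<close> would put
    \<open>p\<close> below \<open>\<Gamma>' x\<close>.\<close>
  have unchanged: "s' x = s x" if "\<not> p \<subseteq> \<Gamma>' x" "sem ev tst C s = Some s'" for x s s'
    using sem_unassigned[OF that(2)] typing_asgn[OF assms(6), of x] that(1) by (auto split: if_splits)
  \<comment> \<open>Stated for stores legal for \<open>\<Gamma>\<close>, so that by monotonicity it
    also covers families legal for a smaller \<open>\<sigma>\<close>.\<close>
  have obs: "mediates (observe ev tst W C g) (\<Otimes>\<^bsub>qoi D\<^esub> w \<in> W. \<Gamma>' w)"
    if "store_legal (hat g) \<Gamma>" for g :: "'v \<Rightarrow> 'd \<Rightarrow> 'a option" and W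
    unfolding observe_def
  proof (rule mediates_tuple)
    show "mediates (map_option (\<lambda>s. s v) \<circ> (sem ev tst C \<circ>\<^sub>m hat g)) (\<Gamma>' v)" for v
      using typing_legal[OF assms(1,2,6) that, of tst] by (simp add: store_legal_def)
    show "\<Gamma>' v \<in> QoI D" for v using assms(5) by (auto simp: envs_def qoi1_iff)
  qed auto
  then have "complies D ev tst C \<sigma> W Pol"
    if "(\<Otimes>\<^bsub>qoi D\<^esub> w \<in> W. \<Gamma>' w) \<subseteq> Pol" "\<sigma> \<le> \<Gamma>" for \<sigma> W Pol
    unfolding complies_def
    using mediates_mono[OF _ that(1)] store_legal_mono[OF legal_hat that(2)] by blast
  moreover have "sem_judgement D ev tst p \<Gamma> C \<Gamma>'"
    unfolding sem_judgement_def
  proof (intro conjI allI impI)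
    show "s' x = s x" if "\<not> p \<subseteq> \<Gamma>' x" "sem ev tst C s = Some s'" for x s s'
      using that by (rule unchanged)
    show "mediates (observe ev tst W C g) (\<Otimes>\<^bsub>qoi D\<^esub> w \<in> W. \<Gamma>' w)"
      if "mediator_family D g \<and> legal g \<Gamma>" for g W
      using that by (intro obs legal_hat) auto
  qed
  ultimately show ?thesis by blast
qed

end
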